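(* Let $k_\hbar$ and $\tilde k_\hbar$ be two good labellings for the $\hbar$-continuous asymptotic lattice $(\mathcal{L}_\hbar,\mathcal{I},B)$, $B\subset\mathbb{R}^n$. Then there exist a unique orientation preserving transformation $\tau\in\mathrm{GA}^+_{\mathbb{Z}}(n,\mathbb{Z})$, independent of $\hbar$, and $\hbar_0>0$, such that $\tilde k_\hbar=\tau\circ k_\hbar$ for all $\hbar\le\hbar_0$, $\hbar\in\mathcal{I}$.
   Context: Asymptotic lattice: let $B\subset\mathbb{R}^n$ be a simply connected bounded open set, $\mathcal{I}\subset(0,\infty)$ a set admitting $0$ as an accumulation point, and for each $\hbar\in\mathcal{I}$ let $\mathcal{L}_\hbar\subset B$ be a discrete subset of $B$. $(\mathcal{L}_\hbar,\mathcal{I},B)$ is an asymptotic lattice if: (1) there exist $\hbar_0>0,\epsilon_0>0,N_0\ge1$ such that for all $\hbar\in\mathcal{I}\cap(0,\hbar_0]$ and all distinct $\lambda_1,\lambda_2\in\mathcal{L}_\hbar$, $\|\lambda_1-\lambda_2\|\ge\epsilon_0\hbar^{N_0}$; (2) there exist a bounded open set $U\subset\mathbb{R}^n$ and smooth maps $G_\hbar:U\to\mathbb{R}^n$, $\hbar\in\mathcal{I}$, with an asymptotic expansion $G_\hbar=G_0+\hbar G_1+\hbar^2G_2+\cdots$ in the $C^\infty(U)$ topology, $G_j\in C^\infty(U;\mathbb{R}^n)$, such that $G_0$ is an orientation preserving diffeomorphism from $U$ onto a neighborhood of $\overline B$, and there are positive numbers $(C_N)_{N\in\mathbb{N}}$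 such that for all $\hbar\in\mathcal{I}$: (a) for all $\lambda\in\mathcal{L}_\hbar$ there is $k\in\mathbb{Z}^n$ with $\hbar k\in U$ and $\|\lambda-G_\hbar(\hbar k)\|\le C_N\hbar^N$ for all $N\in\mathbb{N}$ $( * )$; (b) for every open set $\tilde U_0\Subset G_0^{-1}(B)$ there is $\tilde\hbar_0>0$ such that for all $\hbar\in\mathcal{I}\cap(0,\tilde\hbar_0]$ and all $k\in\mathbb{Z}^n$ with $\hbar k\in\tilde U_0$ there is $\lambda\in\mathcal{L}_\hbar$ with $( * )$. Such $(G_\hbar,U)$ is called an asymptotic chart. ($A\Subset B$ means $\overline A$ is compact and contained in $B$.) Good labelling: given an asymptotic chart $G_\hbar$, for $\hbar$ small there is a unique map $k_\hbar:\mathcal{L}_\hbar\to\mathbb{Z}^n$ such that $( * )$ holds with $k=k_\hbar(\lambda)$ for every $\lambda\in\mathcal{L}_\hbar$ (it is injective); such a family $k_\hbar$ is called a good labelling (associated with $G_\hbar$). $\hbar$-continuity: for all $\epsilon>0$ there exists $\hbar_0>0$ such that for all $\hbar_1\in\overline{\mathcal{I}}\setminus\{0\}$ with $\hbar_1<\hbar_0$ there exists $\hbar_2\in\mathcal{I}$, $\hbar_2<\hbar_1$, with $\frac1{\hbar_2}-\frac1{\hbar_1}<\epsilon$. $\mathrm{GA}^+_{\mathbb{Z}}(n,\mathbb{Z})=\mathrm{SL}(n,\mathbb{Z})\ltimes\mathbb{Z}^n$ is the group of maps $k\mapsto Ak+\ell$ with $A\in\mathrm{SL}(n,\mathbb{Z})$,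 $\ell\in\mathbb{Z}^n$.
   Formalization: A good labelling is additionally required to keep the points ħk_ħ(λ), for small ħ, in a fixed compact subset of U; without this, charts uncontrolled near the boundary of U give counterexamples. It is automatic if G_ħ tends to G_0 uniformly on U. *)

theory Defs
  imports "HOL-Analysis.Analysis"
begin

section \<open>Smooth maps and asymptotic expansions\<close>

text \<open>Iterated partial derivatives: the list \<open>[i\<^sub>1, \<dots>, i\<^sub>m]\<close> of coordinate indices plays
  the role of the multi-index of \<open>\<partial>\<^sub>i\<^sub>1 \<dots> \<partial>\<^sub>i\<^sub>m\<close>.  Only the values at points of an open set on which
  \<open>f\<close> is smooth are meaningful.\<close>

fun partials :: "'n list \<Rightarrow> (real^'n \<Rightarrow> real^'n) \<Rightarrow> real^'n \<Rightarrow> real^'n" where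
  "partials [] f = f"
| "partials (i # is) f = (\<lambda>x. frechet_derivative (partials is f) (at x) (axis i 1))"

text \<open>\<open>C\<^sup>\<infinity>\<close> on an open set: every iterated partial derivative exists and is differentiable
  (hence continuous).\<close>

definition smooth_on :: "(real^'n) set \<Rightarrow> (real^'n \<Rightarrow> real^'n) \<Rightarrow> bool" where
  "smooth_on U f \<longleftrightarrow> open U \<and> (\<forall>is. \<forall>x\<in>U. partials is f differentiable (at x))"

definition orientation_preserving_diffeo ::
    "(real^'n) set \<Rightarrow> (real^'n) set \<Rightarrow> (real^'n \<Rightarrow> real^'n) \<Rightarrow> bool" where
  "orientation_preserving_diffeo U V f \<longleftrightarrow>
     bij_betw f U V \<and> smooth_on U f \<and> smooth_on V (inv_into U f) \<and>
     (\<forall>x\<in>U. det (jacobian f (at x)) > 0)"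

text \<open>\<open>G\<^sub>h = g\<^sub>0 + h g\<^sub>1 + h\<^sup>2 g\<^sub>2 + \<dots>\<close> for \<open>h \<rightarrow> 0\<close> in \<open>I\<close>, in the Frechet topology of
  \<open>C\<^sup>\<infinity>(U)\<close>: every derivative of every remainder is estimated uniformly on compact subsets
  of \<open>U\<close>.\<close>

definition smooth_expansion ::
    "real set \<Rightarrow> (real^'n) set \<Rightarrow> (real \<Rightarrow> real^'n \<Rightarrow> real^'n) \<Rightarrow> (nat \<Rightarrow> real^'n \<Rightarrow> real^'n) \<Rightarrow> bool"
  where
  "smooth_expansion I U G g \<longleftrightarrow>
     (\<forall>h\<in>I. smooth_on U (G h)) \<and> (\<forall>j. smooth_on U (g j)) \<and>
     (\<forall>K is N. compact K \<and> K \<subseteq> U \<longrightarrow>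
        (\<exists>M. \<exists>h0>0. \<forall>h\<in>I. h \<le> h0 \<longrightarrow> (\<forall>x\<in>K.
           norm (partials is (\<lambda>y. G h y - (\<Sum>j\<le>N. h ^ j *\<^sub>R g j y)) x) \<le> M * h ^ (N + 1))))"


section \<open>Asymptotic lattices\<close>

definition real_vec :: "int^'n \<Rightarrow> real^'n" where
  "real_vec k = (\<chi> i. real_of_int (k $ i))"

text \<open>The relation \<open>\<parallel>p - G\<^sub>h(h k)\<parallel> \<le> C\<^sub>N h\<^sup>N\<close> for all \<open>N\<close>; the point \<open>h k\<close> is required separately
  to lie in the domain \<open>U\<close>.\<close>

definition chart_label ::
    "(nat \<Rightarrow> real) \<Rightarrow> (real \<Rightarrow> real^'n \<Rightarrow> real^'n) \<Rightarrow> real \<Rightarrow> real^'n \<Rightarrow> int^'n \<Rightarrow> bool" where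
  "chart_label C G h p k \<longleftrightarrow> (\<forall>N. norm (p - G h (h *\<^sub>R real_vec k)) \<le> C N * h ^ N)"

definition asymptotic_chart ::
    "(real \<Rightarrow> (real^'n) set) \<Rightarrow> real set \<Rightarrow> (real^'n) set \<Rightarrow> (real^'n) set \<Rightarrow>
     (real \<Rightarrow> real^'n \<Rightarrow> real^'n) \<Rightarrow> (nat \<Rightarrow> real^'n \<Rightarrow> real^'n) \<Rightarrow> (nat \<Rightarrow> real) \<Rightarrow> bool" where
  "asymptotic_chart L I B U G g C \<longleftrightarrow>
     open U \<and> bounded U \<and>
     smooth_expansion I U G g \<and>
     (\<exists>V. closure B \<subseteq> V \<and> orientation_preserving_diffeo U V (g 0)) \<and>
     (\<forall>N. C N > 0) \<and>
     (\<forall>h\<in>I. \<forall>p\<in>L h. \<exists>k. h *\<^sub>R real_vec k \<in> U \<and> chart_label C G h p k) \<and>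
     (\<forall>W. open W \<and> compact (closure W) \<and> closure W \<subseteq> {x\<in>U. g 0 x \<in> B} \<longrightarrow>
        (\<exists>h0>0. \<forall>h\<in>I. h \<le> h0 \<longrightarrow>
           (\<forall>k. h *\<^sub>R real_vec k \<in> W \<longrightarrow> (\<exists>p\<in>L h. chart_label C G h p k))))"

text \<open>\<open>simply_connected\<close> holds for the empty set, which is excluded here.\<close>

definition asymptotic_lattice ::
    "(real \<Rightarrow> (real^'n) set) \<Rightarrow> real set \<Rightarrow> (real^'n) set \<Rightarrow> bool" where
  "asymptotic_lattice L I B \<longleftrightarrow>
     B \<noteq> {} \<and> simply_connected B \<and> bounded B \<and> open B \<and>
     I \<subseteq> {0<..} \<and> 0 islimpt I \<and>
     (\<forall>h\<in>I. L h \<subseteq> B \<and> discrete (L h)) \<and>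
     (\<exists>h0>0. \<exists>e0>0. \<exists>N0\<ge>1. \<forall>h\<in>I. h \<le> h0 \<longrightarrow>
        (\<forall>p1\<in>L h. \<forall>p2\<in>L h. p1 \<noteq> p2 \<longrightarrow> norm (p1 - p2) \<ge> e0 * h ^ (N0::nat))) \<and>
     (\<exists>U G g C. asymptotic_chart L I B U G g C)"

definition hbar_continuous :: "real set \<Rightarrow> bool" where
  "hbar_continuous I \<longleftrightarrow>
     (\<forall>e>0. \<exists>h0>0. \<forall>h1\<in>closure I - {0}. h1 < h0 \<longrightarrow>
        (\<exists>h2\<in>I. h2 < h1 \<and> 1 / h2 - 1 / h1 < e))"

text \<open>A good labelling is a family \<open>k\<^sub>h\<close> of labels for an asymptotic chart, defined for small \<open>h\<close>
  (the values \<open>k h p\<close> for other \<open>h\<close>, or for \<open>p \<notin> L h\<close>, are irrelevant).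

  The labelled points \<open>h k\<^sub>h(p)\<close> have to stay in some compact subset \<open>K\<close> of \<open>U\<close>.  The topology
  of \<open>C\<^sup>\<infinity>(U)\<close> does not control \<open>G\<^sub>h\<close> near the boundary of \<open>U\<close>; with \<open>h k\<^sub>h(p) \<in> U\<close> alone, labels
  close to that boundary, unrelated to the diffeomorphism \<open>g\<^sub>0\<close>, would be admitted, and labels
  associated with a chart would not be unique for small \<open>h\<close>.  If \<open>G\<^sub>h\<close> converges to \<open>g\<^sub>0\<close>
  uniformly on \<open>U\<close>, the condition holds automatically: see \<open>compact_labels\<close> below.\<close>

definition good_labelling ::
    "(real \<Rightarrow> (real^'n) set) \<Rightarrow> real set \<Rightarrow> (real^'n) set \<Rightarrow> (real \<Rightarrow> real^'n \<Rightarrow> int^'n) \<Rightarrow> bool"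
  where
  "good_labelling L I B k \<longleftrightarrow>
     (\<exists>U G g C. asymptotic_chart L I B U G g C \<and>
        (\<exists>K h0. compact K \<and> K \<subseteq> U \<and> h0 > 0 \<and>
           (\<forall>h\<in>I. h \<le> h0 \<longrightarrow> (\<forall>p\<in>L h.
              h *\<^sub>R real_vec (k h p) \<in> K \<and> chart_label C G h p (k h p)))))"

lemma compact_labels:
  fixes L :: "real \<Rightarrow> (real^'n) set"
  assumes lattice: "asymptotic_lattice L I B"
    and chart: "asymptotic_chart L I B U G g C"
    and unif: "uniform_limit U G (g 0) (at 0 within I)"
    and "h1 > 0"
    and lab: "\<And>h p. h \<in> I \<Longrightarrow> h \<le> h1 \<Longrightarrow> p \<in> L h \<Longrightarrow>
                h *\<^sub>R real_vec (k h p) \<in> U \<and> chart_label C G h p (k h p)"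
  shows "good_labelling L I B k"
proof -
  have B: "bounded B" and I: "I \<subseteq> {0<..}" and LB: "\<And>h. h \<in> I \<Longrightarrow> L h \<subseteq> B"
    using lattice by (auto simp: asymptotic_lattice_def)
  obtain V where V: "closure B \<subseteq> V" "bij_betw (g 0) U V" "smooth_on V (inv_into U (g 0))"
    using chart by (auto simp: asymptotic_chart_def orientation_preserving_diffeo_def)
  have C: "C 1 > 0" using chart by (auto simp: asymptotic_chart_def)
  have "open V" using V(3) by (simp add: smooth_on_def)
  obtain d where d: "d > 0" "(\<Union>x\<in>closure B. cball x d) \<subseteq> V"
    using compact_subset_open_imp_cball_epsilon_subset[of "closure B" V] B V(1) \<open>open V\<close> by auto
  define Q where "Q = {x + y |x y. x \<in> closure B \<and> y \<in> cball 0 d}"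
  have Q: "compact Q"
    unfolding Q_def using B by (intro compact_sums) auto
  have "Q \<subseteq> (\<Union>x\<in>closure B. cball x d)"
    by (force simp: Q_def dist_norm)
  hence QV: "Q \<subseteq> V" using d(2) by blast
  have "\<And>x. x \<in> V \<Longrightarrow> inv_into U (g 0) differentiable (at x)"
    using V(3) unfolding smooth_on_def by (metis partials.simps(1))
  hence "continuous_on V (inv_into U (g 0))"
    by (meson continuous_at_imp_continuous_on differentiable_imp_continuous_within)
  hence K: "compact (inv_into U (g 0) ` Q)"
    using Q QV by (meson compact_continuous_image continuous_on_subset)
  have KU: "inv_into U (g 0) ` Q \<subseteq> U"
    using V(2) QV by (metis bij_betw_def image_mono inv_into_image_cancel order_refl
        image_subset_iff inv_into_into subset_iff)
  have "\<forall>\<^sub>F h in at 0 within I. \<forall>x\<in>U. dist (G h x) (g 0 x) < d / 2"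
    using unif half_gt_zero[OF d(1)] unfolding uniform_limit_iff by blast
  then obtain h2 where h2: "h2 > 0"
    "\<And>h. h \<in> I \<Longrightarrow> h < h2 \<Longrightarrow> \<forall>x\<in>U. dist (G h x) (g 0 x) < d / 2"
    using I unfolding eventually_at by (fastforce simp: dist_real_def)
  define h0 where "h0 = Min {h1, h2 / 2, d / (2 * C 1)}"
  have h0: "h0 > 0" "h0 \<le> h1" "h0 < h2" "h0 \<le> d / (2 * C 1)"
    using \<open>h1 > 0\<close> h2(1) d(1) C by (auto simp: h0_def min_def)
  have "h *\<^sub>R real_vec (k h p) \<in> inv_into U (g 0) ` Q"
    if h: "h \<in> I" "h \<le> h0" "p \<in> L h" for h p
  proof -
    let ?x = "h *\<^sub>R real_vec (k h p)"
    have x: "?x \<in> U" "norm (p - G h ?x) \<le> C 1 * h"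
      using lab[of h p] h h0 unfolding chart_label_def
      by (auto dest: spec[of _ 1])
    have "C 1 * h \<le> C 1 * (d / (2 * C 1))"
      using h h0 C by (intro mult_left_mono) auto
    hence 1: "norm (p - G h ?x) \<le> d / 2" using x(2) C by simp
    have 2: "norm (G h ?x - g 0 ?x) < d / 2"
      using h2(2)[of h] h h0 x(1) by (simp add: dist_norm)
    have "norm (g 0 ?x - p) \<le> d"
      using 1 2 norm_triangle_ineq[of "p - G h ?x" "G h ?x - g 0 ?x"]
      by (simp add: norm_minus_commute)
    moreover have "p \<in> closure B" using h LB closure_subset by blast
    ultimately have "g 0 ?x \<in> Q"
      unfolding Q_def mem_Collect_eq
      by (intro exI[of _ p] exI[of _ "g 0 ?x - p"]) simp
    moreover have "inv_into U (g 0) (g 0 ?x) = ?x"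
      using V(2) x(1) by (simp add: bij_betw_def inv_into_f_f)
    ultimately show ?thesis by (metis imageI)
  qed
  thus ?thesis
    unfolding good_labelling_def using chart K KU h0 lab
    by (meson order_trans)
qed


section \<open>Integral affine transformations\<close>

text \<open>The group \<open>SL(n,\<int>) \<ltimes> \<int>\<^sup>n\<close>, acting on \<open>\<int>\<^sup>n\<close>.\<close>

definition GA_plus :: "(int^'n \<Rightarrow> int^'n) set" where
  "GA_plus = {\<tau>. \<exists>A l. det A = 1 \<and> \<tau> = (\<lambda>k. A *v k + l)}"

end

theory Submission
  imports Defs
begin

text \<open>
  Write \<open>\<psi>\<close> for the inverse of the leading part \<open>g\<^sub>0\<close> of a chart.  Inverting
  \<open>p = g\<^sub>0(x) + h g\<^sub>1(x) + O(h\<^sup>2)\<close> at \<open>x = h k\<^sub>h(p)\<close> shows that along points \<open>p \<in> L h\<close> tending to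
  \<open>w \<in> closure B\<close>,
  \<open>k\<^sub>h(p) = \<psi>(p)/h + e(w) + o(1)\<close>, where \<open>e(w) = - D\<psi>(w)(g\<^sub>1(\<psi>(w)))\<close>
  (\<open>label_asymptotics\<close>).  Both labellings are thus compared through the points \<open>p\<close> themselves,
  without inverting the \<open>h\<close>-dependent charts.  The other ingredient is that near a point
  of \<open>B\<close> every integer vector of the right size is a label (\<open>label_realised\<close>).

  Let \<open>\<psi>'\<close>, \<open>e'\<close> belong to the second labelling.  Take two points of \<open>L h\<close> near \<open>w \<in> B\<close> whose
  \<open>k\<close>-labels differ by a unit vector \<open>u\<close>.  The difference of their \<open>k'\<close>-labels is an integer vector that
  converges to \<open>D\<psi>'(w) Dg\<^sub>0(\<psi>(w)) u\<close>, so this derivative is integral.  It is continuous in \<open>w\<close>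
  and \<open>B\<close> is connected, so it is one integer matrix \<open>A\<close>; exchanging the labellings gives an
  integral inverse, and since charts preserve orientation, \<open>det A = 1\<close>.  Hence
  \<open>\<psi>' = A \<psi> + b\<close> on \<open>B\<close>, and
  \<open>k'\<^sub>h(p) - A k\<^sub>h(p) = b/h + c(w) + o(1)\<close> with \<open>c = e' - A e\<close>,
  for \<open>p \<in> L h\<close> tending to any \<open>w \<in> closure B\<close>.

  The left hand side is integral.  If \<open>h\<close> could only jump, the drift \<open>b/h\<close> might be compatible with
  this; but \<open>h\<close>-continuity makes \<open>1/h\<close> move by arbitrarily small steps, along which an integer
  cannot change, so \<open>b = 0\<close> (\<open>hbar_continuous_imp_no_drift\<close>).  Then \<open>c\<close> is integral on \<open>B\<close>, hence a constant
  \<open>l\<close>, also on \<open>closure B\<close>.  Since \<open>closure B\<close> is compact, \<open>k'\<^sub>h(p) - A k\<^sub>h(p)\<close> converges to \<open>l\<close>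
  uniformly in \<open>p \<in> L h\<close>, and being integral it equals \<open>l\<close> for small \<open>h\<close>.  Points close to
  the boundary of \<open>B\<close> need no separate treatment, because the asymptotics hold up to the boundary.

  Uniqueness: for small \<open>h\<close> some \<open>\<kappa>\<close> and all \<open>\<kappa> + axis i 1\<close> are labels, and their images determine an affine map.
\<close>

section \<open>Integer vectors and matrices\<close>

lemma real_vec_diff: "real_vec (a - b) = real_vec a - real_vec b"
  by (simp add: real_vec_def vec_eq_iff)

lemma real_vec_nth [simp]: "real_vec a $ i = real_of_int (a $ i)"
  by (simp add: real_vec_def)

lemma real_vec_eq_iff [simp]: "real_vec a = real_vec b \<longleftrightarrow> a = b"
  by (simp add: vec_eq_iff)

lemma real_vec_axis: "real_vec (axis i 1) = axis i 1"
  by (simp add: vec_eq_iff axis_def)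

lemma real_vec_matrix_vector_mult:
  fixes A :: "int^'n^'m" and a :: "int^'n"
  shows "real_vec (A *v a) = map_matrix real_of_int A *v real_vec a"
  by (simp add: vec_eq_iff matrix_vector_mult_def)

lemma det_map_matrix_of_int:
  fixes A :: "int^'n^'n"
  shows "det (map_matrix real_of_int A) = real_of_int (det A)"
  by (simp add: det_def)

lemma eq_if_real_vec_close:
  assumes "norm (real_vec a - real_vec b) < 1"
  shows "a = b"
proof (rule vec_eq_iff[THEN iffD2], rule allI)
  fix i
  have "\<bar>real_of_int (a $ i) - real_of_int (b $ i)\<bar> < 1"
    using component_le_norm_cart[of "real_vec a - real_vec b" i] assms by simp
  then show "a $ i = b $ i" by linarith
qed

lemma real_vec_tendsto_imp_eventually_const:
  assumes lim: "((\<lambda>j. real_vec (m j)) \<longlongrightarrow> v) F" and "F \<noteq> bot"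
  obtains z where "v = real_vec z" "\<forall>\<^sub>F j in F. m j = z"
proof -
  have ev: "\<forall>\<^sub>F j in F. dist (real_vec (m j)) v < 1/2"
    using lim by (rule tendstoD) simp
  obtain j0 where j0: "dist (real_vec (m j0)) v < 1/2"
    using eventually_happens'[OF \<open>F \<noteq> bot\<close> ev] by blast
  have const: "\<forall>\<^sub>F j in F. m j = m j0"
    using ev
  proof eventually_elim
    case (elim j)
    then have "dist (real_vec (m j)) (real_vec (m j0)) < 1"
      using j0 dist_triangle_half_l by (metis dist_commute)
    then show ?case by (intro eq_if_real_vec_close) (simp add: dist_norm)
  qed
  have "((\<lambda>j. real_vec (m j)) \<longlongrightarrow> real_vec (m j0)) F"
    using const by (intro tendsto_eventually) (auto elim: eventually_mono)
  then have "v = real_vec (m j0)"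
    using lim \<open>F \<noteq> bot\<close> tendsto_unique by blast
  then show thesis using const that by blast
qed

lemma constant_if_integral_differences:
  fixes f :: "'a::metric_space \<Rightarrow> real^'n"
  assumes "connected S" "continuous_on S f"
    and int: "\<And>x y. x \<in> S \<Longrightarrow> y \<in> S \<Longrightarrow> \<exists>z. f x - f y = real_vec z"
    and "x \<in> S" "y \<in> S"
  shows "f x = f y"
proof (rule connected_local_const[where f=f, OF \<open>connected S\<close> \<open>x\<in>S\<close> \<open>y\<in>S\<close>], rule ballI)
  fix a assume a: "a \<in> S"
  have "(f \<longlongrightarrow> f a) (at a within S)"
    using assms(2) a by (simp add: continuous_on_def)
  then have "\<forall>\<^sub>F b in at a within S. dist (f b) (f a) < 1"
    by (rule tendstoD) simp
  moreover have "\<forall>\<^sub>F b in at a within S. b \<in> S"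
    by (simp add: eventually_at_filter)
  ultimately show "\<forall>\<^sub>F b in at a within S. f a = f b"
  proof eventually_elim
    case (elim b)
    obtain z where z: "f b - f a = real_vec z" using int elim a by blast
    have zero: "real_vec (0 :: int^'n) = 0" by (simp add: vec_eq_iff)
    have "z = 0"
      using elim z by (intro eq_if_real_vec_close) (simp add: dist_norm zero)
    then show ?case using z zero by simp
  qed
qed

text \<open>Every point is a limit of points of \<open>h \<int>\<^sup>n\<close>; the fixed offset \<open>a\<close> gives its lattice
  neighbours as well.\<close>

lemma floor_vec_tendsto:
  fixes x :: "real^'n" and a :: "int^'n"
  assumes "I \<subseteq> {0<..}"
  shows "((\<lambda>h. h *\<^sub>R real_vec ((\<chi> i. \<lfloor>x $ i / h\<rfloor>) + a)) \<longlongrightarrow> x) (at 0 within I)"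
proof (rule vec_tendstoI)
  fix i
  have id: "((\<lambda>h::real. h) \<longlongrightarrow> 0) (at 0 within I)" by (rule tendsto_ident_at)
  have pos: "\<forall>\<^sub>F h in at 0 within I. h > 0"
    using assms by (auto simp: eventually_at intro!: exI[of _ 1])
  have "((\<lambda>h. h * real_of_int \<lfloor>x $ i / h\<rfloor>) \<longlongrightarrow> x $ i) (at 0 within I)"
  proof (rule tendsto_sandwich)
    show "\<forall>\<^sub>F h in at 0 within I. x $ i - h \<le> h * real_of_int \<lfloor>x $ i / h\<rfloor>"
      using pos
    proof eventually_elim
      case (elim h)
      have "x $ i / h - 1 \<le> real_of_int \<lfloor>x $ i / h\<rfloor>" by linarith
      from mult_left_mono[OF this, of h] elim show ?case by (simp add: algebra_simps)
    qed
    show "\<forall>\<^sub>F h in at 0 within I. h * real_of_int \<lfloor>x $ i / h\<rfloor> \<le> x $ i"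
      using pos
    proof eventually_elim
      case (elim h)
      have "real_of_int \<lfloor>x $ i / h\<rfloor> \<le> x $ i / h" by linarith
      from mult_left_mono[OF this, of h] elim show ?case by simp
    qed
    show "((\<lambda>h. x $ i - h) \<longlongrightarrow> x $ i) (at 0 within I)"
      by (auto intro!: tendsto_eq_intros)
  qed simp
  moreover have "((\<lambda>h. h * real_of_int (a $ i)) \<longlongrightarrow> 0) (at 0 within I)"
    by (auto intro!: tendsto_eq_intros)
  ultimately have "((\<lambda>h. h * real_of_int \<lfloor>x $ i / h\<rfloor> + h * real_of_int (a $ i))
      \<longlongrightarrow> x $ i + 0) (at 0 within I)"
    by (rule tendsto_add)
  then show "((\<lambda>h. (h *\<^sub>R real_vec ((\<chi> i. \<lfloor>x $ i / h\<rfloor>) + a)) $ i) \<longlongrightarrow> x $ i) (at 0 within I)"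
    by (simp add: distrib_left)
qed


section \<open>Difference quotients of smooth maps\<close>

lemma smooth_on_has_derivative:
  assumes "smooth_on V f" "x \<in> V"
  shows "(f has_derivative frechet_derivative f (at x)) (at x)"
  using assms unfolding smooth_on_def frechet_derivative_works[symmetric]
  by (metis partials.simps(1))

lemma smooth_on_continuous_on:
  assumes "smooth_on V f"
  shows "continuous_on V f"
  using smooth_on_has_derivative[OF assms]
  by (meson continuous_at_imp_continuous_on has_derivative_continuous)

lemma smooth_on_continuous_on_derivative:
  fixes f :: "real^'n \<Rightarrow> real^'n"
  assumes f: "smooth_on V f" and w: "continuous_on V w"
  shows "continuous_on V (\<lambda>x. frechet_derivative f (at x) (w x))"
proof -
  have partial: "continuous_on V (\<lambda>x. frechet_derivative f (at x) (axis i 1))" for i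
  proof (rule continuous_at_imp_continuous_on, rule ballI)
    fix x assume "x \<in> V"
    then have "partials [i] f differentiable (at x)" using f unfolding smooth_on_def by blast
    then show "continuous (at x) (\<lambda>x. frechet_derivative f (at x) (axis i 1))"
      using differentiable_imp_continuous_within by force
  qed
  have "continuous_on V (\<lambda>x. \<Sum>i\<in>UNIV. (w x $ i) *\<^sub>R frechet_derivative f (at x) (axis i 1))"
    using w by (intro continuous_intros partial) 
  moreover have "frechet_derivative f (at x) (w x)
      = (\<Sum>i\<in>UNIV. (w x $ i) *\<^sub>R frechet_derivative f (at x) (axis i 1))" if "x \<in> V" for x
  proof -
    interpret linear "frechet_derivative f (at x)"
      using smooth_on_has_derivative[OF f that] has_derivative_linear by blast
    have "w x = (\<Sum>i\<in>UNIV. (w x $ i) *\<^sub>R axis i 1)"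
      using basis_expansion[of "w x"] by (simp add: scalar_mult_eq_scaleR)
    then have "frechet_derivative f (at x) (w x)
        = frechet_derivative f (at x) (\<Sum>i\<in>UNIV. (w x $ i) *\<^sub>R axis i 1)"
      by (rule arg_cong)
    then show ?thesis by (simp add: sum scale)
  qed
  ultimately show ?thesis by (metis (no_types, lifting) continuous_on_cong)
qed

lemma norm_linear_le_sum_axis:
  fixes T :: "real^'n \<Rightarrow> real^'n"
  assumes "linear T"
  shows "norm (T v) \<le> (\<Sum>i\<in>UNIV. norm (T (axis i 1))) * norm v"
proof -
  interpret linear T by fact
  have "T v = T (\<Sum>i\<in>UNIV. (v $ i) *\<^sub>R axis i 1)"
    using basis_expansion[of v] by (simp add: scalar_mult_eq_scaleR)
  also have "\<dots> = (\<Sum>i\<in>UNIV. (v $ i) *\<^sub>R T (axis i 1))" by (simp add: sum scale)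
  also have "norm \<dots> \<le> (\<Sum>i\<in>UNIV. norm (T (axis i 1)) * norm v)"
    by (rule sum_norm_le) (simp add: mult.commute[of _ "norm v"] mult_right_mono component_le_norm_cart)
  finally show ?thesis by (simp add: sum_distrib_right)
qed

text \<open>A \<open>C\<^sup>1\<close> map is strictly differentiable: on a small ball the derivative differs from
  the one at the centre by at most \<open>e\<close>, so the mean value inequality applies to the map minus
  its linearisation.\<close>

lemma smooth_on_strict_derivative:
  fixes f :: "real^'n \<Rightarrow> real^'n"
  assumes f: "smooth_on V f" and w: "w \<in> V" and "e > 0"
  obtains r where "r > 0"
    "\<And>x y. x \<in> ball w r \<Longrightarrow> y \<in> ball w r \<Longrightarrow>
       norm (f x - f y - frechet_derivative f (at w) (x - y)) \<le> e * norm (x - y)"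
proof -
  let ?D = "\<lambda>x. frechet_derivative f (at x)"
  let ?s = "\<lambda>x. \<Sum>i\<in>UNIV. norm (?D x (axis i 1) - ?D w (axis i 1))"
  have V: "open V" using f by (simp add: smooth_on_def)
  have "continuous_on V ?s"
    by (rule continuous_on_sum, rule continuous_on_norm, rule continuous_on_diff,
        rule smooth_on_continuous_on_derivative[OF f]) (rule continuous_on_const)+
  then have "(?s \<longlongrightarrow> ?s w) (at w within V)"
    using w unfolding continuous_on_def by (rule bspec)
  then have "(?s \<longlongrightarrow> ?s w) (at w)"
    unfolding at_within_open[OF w V] .
  then have "(?s \<longlongrightarrow> 0) (at w)" by simp
  then have "\<forall>\<^sub>F x in at w. ?s x < e"
    using order_tendstoD(2) \<open>e > 0\<close> by blast
  then obtain d where d: "d > 0" "\<And>x. x \<noteq> w \<Longrightarrow> dist x w < d \<Longrightarrow> ?s x < e"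
    by (auto simp: eventually_at)
  obtain d' where d': "d' > 0" "ball w d' \<subseteq> V"
    using V w open_contains_ball by blast
  let ?r = "min d d'"
  have small: "?s x \<le> e" if "x \<in> ball w ?r" for x
    using d(2)[of x] that \<open>e > 0\<close> by (cases "x = w") (auto simp: dist_commute)
  have lin: "linear (?D w)"
    using smooth_on_has_derivative[OF f w] has_derivative_linear by blast
  have "norm (f x - f y - ?D w (x - y)) \<le> e * norm (x - y)"
    if xy: "x \<in> ball w ?r" "y \<in> ball w ?r" for x y
  proof -
    have "norm ((f x - ?D w x) - (f y - ?D w y)) \<le> e * norm (x - y)"
    proof (rule differentiable_bound[where S="ball w ?r" and f'="\<lambda>z v. ?D z v - ?D w v"])
      fix z assume z: "z \<in> ball w ?r"
      then have zV: "z \<in> V" using d'(2) by auto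
      show "((\<lambda>x. f x - ?D w x) has_derivative (\<lambda>v. ?D z v - ?D w v)) (at z within ball w ?r)"
        using smooth_on_has_derivative[OF f zV] lin
        by (intro has_derivative_diff has_derivative_at_withinI[OF linear_imp_has_derivative])
           (auto intro: has_derivative_at_withinI)
      have "linear (?D z)"
        using smooth_on_has_derivative[OF f zV] has_derivative_linear by blast
      then have "linear (\<lambda>v. ?D z v - ?D w v)"
        using lin by (rule linear_compose_sub)
      then have "norm (?D z v - ?D w v) \<le> e * norm v" for v
        by (rule order_trans[OF norm_linear_le_sum_axis[of "\<lambda>v. ?D z v - ?D w v"]
              mult_right_mono[OF small[OF z] norm_ge_zero]])
      then show "onorm (\<lambda>v. ?D z v - ?D w v) \<le> e"
        by (rule onorm_le)
    qed (use xy in auto)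
    then show ?thesis by (simp add: linear_diff[OF lin] algebra_simps)
  qed
  then show thesis using that[of ?r] d(1) d'(1) by simp
qed

text \<open>Unlike in the definition of the derivative, both arguments move with \<open>j\<close>.\<close>

lemma smooth_on_difference_quotient:
  fixes f :: "real^'n \<Rightarrow> real^'n" and h :: "'j \<Rightarrow> real"
  assumes f: "smooth_on V f" and w: "w \<in> V"
    and a: "(a \<longlongrightarrow> w) F" and b: "(b \<longlongrightarrow> w) F"
    and quot: "((\<lambda>j. (a j - b j) /\<^sub>R h j) \<longlongrightarrow> d) F"
  shows "((\<lambda>j. (f (a j) - f (b j)) /\<^sub>R h j) \<longlongrightarrow> frechet_derivative f (at w) d) F"
proof -
  let ?T = "frechet_derivative f (at w)"
  have lin: "linear ?T"
    using smooth_on_has_derivative[OF f w] has_derivative_linear by blast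
  let ?R = "\<lambda>j. (f (a j) - f (b j) - ?T (a j - b j)) /\<^sub>R h j"
  have "(?R \<longlongrightarrow> 0) F"
  proof (rule tendstoI)
    fix e :: real assume e: "e > 0"
    define e' where "e' = e / (norm d + 1)"
    have e': "e' > 0" using e by (simp add: e'_def add_nonneg_pos)
    obtain r where r: "r > 0" "\<And>x y. x \<in> ball w r \<Longrightarrow> y \<in> ball w r \<Longrightarrow>
        norm (f x - f y - ?T (x - y)) \<le> e' * norm (x - y)"
      using smooth_on_strict_derivative[OF f w e'] by blast
    have "((\<lambda>j. norm ((a j - b j) /\<^sub>R h j)) \<longlongrightarrow> norm d) F"
      using quot by (rule tendsto_norm)
    then have "\<forall>\<^sub>F j in F. norm ((a j - b j) /\<^sub>R h j) < norm d + 1"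
      by (rule order_tendstoD) simp
    then show "\<forall>\<^sub>F j in F. dist (?R j) 0 < e"
      using tendstoD[OF a r(1)] tendstoD[OF b r(1)]
    proof eventually_elim
      case (elim j)
      have "norm (?R j) = norm (f (a j) - f (b j) - ?T (a j - b j)) / \<bar>h j\<bar>"
        by (simp add: divide_inverse)
      also have "\<dots> \<le> e' * norm (a j - b j) / \<bar>h j\<bar>"
        using elim by (intro divide_right_mono r) (auto simp: dist_commute)
      also have "\<dots> = e' * norm ((a j - b j) /\<^sub>R h j)"
        by (simp add: divide_inverse)
      also have "\<dots> < e' * (norm d + 1)"
        using elim e' by (intro mult_strict_left_mono) auto
      also have "\<dots> = e" using norm_ge_zero[of d] by (simp add: e'_def add_nonneg_eq_0_iff)
      finally show ?case by simp
    qed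
  qed
  moreover have "((\<lambda>j. ?T ((a j - b j) /\<^sub>R h j)) \<longlongrightarrow> ?T d) F"
    using quot lin linear_conv_bounded_linear bounded_linear.tendsto by blast
  ultimately have "((\<lambda>j. ?R j + ?T ((a j - b j) /\<^sub>R h j)) \<longlongrightarrow> 0 + ?T d) F"
    by (rule tendsto_add)
  then show ?thesis
    by (simp add: linear_cmul[OF lin] flip: scaleR_add_right)
qed

lemma derivative_left_inverse:
  assumes f: "smooth_on S f" and g: "smooth_on T g"
    and x: "x \<in> S" "f x \<in> T" and inv: "\<And>y. y \<in> S \<Longrightarrow> g (f y) = y"
  shows "frechet_derivative g (at (f x)) (frechet_derivative f (at x) v) = v"
proof -
  have "(g \<circ> f has_derivative frechet_derivative g (at (f x)) \<circ> frechet_derivative f (at x)) (at x)"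
    using smooth_on_has_derivative[OF f x(1)] smooth_on_has_derivative[OF g x(2)]
    by (rule diff_chain_at)
  moreover have "(g \<circ> f has_derivative id) (at x)"
    using f x(1) inv
    by (intro has_derivative_transform_within_open[OF has_derivative_id[unfolded id_def[symmetric]]])
       (auto simp: smooth_on_def)
  ultimately have "frechet_derivative g (at (f x)) \<circ> frechet_derivative f (at x) = id"
    by (rule has_derivative_unique)
  then show ?thesis by (metis comp_apply id_apply)
qed


section \<open>Asymptotics of a single labelling\<close>

text \<open>A good labelling together with a chart and the other data that witness it.\<close>

locale labelled_chart =
  fixes L :: "real \<Rightarrow> (real^'n) set" and I :: "real set" and B :: "(real^'n) set"
    and U V :: "(real^'n) set" and G :: "real \<Rightarrow> real^'n \<Rightarrow> real^'n"
    and g :: "nat \<Rightarrow> real^'n \<Rightarrow> real^'n" and C :: "nat \<Rightarrow> real"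
    and K :: "(real^'n) set" and k :: "real \<Rightarrow> real^'n \<Rightarrow> int^'n" and h0 :: real
  assumes lattice: "asymptotic_lattice L I B"
    and chart: "asymptotic_chart L I B U G g C"
    and closure_B: "closure B \<subseteq> V"
    and diffeo: "orientation_preserving_diffeo U V (g 0)"
    and compact_K: "compact K" and K_subset: "K \<subseteq> U" and h0_pos: "h0 > 0"
    and labels: "\<And>h p. h \<in> I \<Longrightarrow> h \<le> h0 \<Longrightarrow> p \<in> L h \<Longrightarrow>
                   h *\<^sub>R real_vec (k h p) \<in> K \<and> chart_label C G h p (k h p)"
begin

definition \<psi> :: "real^'n \<Rightarrow> real^'n" where
  "\<psi> = inv_into U (g 0)"

text \<open>The constant term in the expansion of the labels in powers of \<open>h\<close>: see
  \<open>label_asymptotics\<close>.\<close>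

definition label_shift :: "real^'n \<Rightarrow> real^'n" where
  "label_shift p = frechet_derivative \<psi> (at p) (- g 1 (\<psi> p))"

lemma smooth_g: "smooth_on U (g j)"
  using chart by (simp add: asymptotic_chart_def smooth_expansion_def)

lemma smooth_\<psi>: "smooth_on V \<psi>"
  using diffeo by (simp add: orientation_preserving_diffeo_def \<psi>_def)

lemma bij_g: "bij_betw (g 0) U V"
  using diffeo by (simp add: orientation_preserving_diffeo_def)

lemma \<psi>_g: "x \<in> U \<Longrightarrow> \<psi> (g 0 x) = x"
  using bij_g by (simp add: \<psi>_def bij_betw_def)

lemma g_\<psi>: "p \<in> V \<Longrightarrow> g 0 (\<psi> p) = p"
  using bij_g by (simp add: \<psi>_def bij_betw_inv_into_right)

lemma \<psi>_in_U: "p \<in> V \<Longrightarrow> \<psi> p \<in> U"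
  using bij_betw_inv_into[OF bij_g] by (auto simp: \<psi>_def bij_betw_def)

lemma B_subset_V: "B \<subseteq> V"
  using closure_B closure_subset by blast

lemma I_pos: "h \<in> I \<Longrightarrow> h > 0"
  using lattice by (auto simp: asymptotic_lattice_def)

lemma L_subset_B: "h \<in> I \<Longrightarrow> L h \<subseteq> B"
  using lattice by (simp add: asymptotic_lattice_def)

lemma open_B: "open B" and connected_B: "connected B" and bounded_B: "bounded B"
  and B_nonempty: "B \<noteq> {}"
  using lattice by (auto simp: asymptotic_lattice_def simply_connected_imp_connected)

lemma at_0_within_I_nontrivial: "at 0 within I \<noteq> bot"
  using lattice by (simp add: asymptotic_lattice_def trivial_limit_within)

lemma eventually_in_I: "\<forall>\<^sub>F h in at 0 within I. h \<in> I"
  by (simp add: eventually_at_filter)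

lemma continuous_on_\<psi>: "continuous_on V \<psi>"
  using smooth_\<psi> by (rule smooth_on_continuous_on)

lemma continuous_on_g_\<psi>: "continuous_on V (\<lambda>p. g j (\<psi> p))"
  using continuous_on_compose2[OF smooth_on_continuous_on[OF smooth_g] continuous_on_\<psi>] \<psi>_in_U
  by blast

lemma continuous_on_label_shift: "continuous_on V label_shift"
  unfolding label_shift_def
  by (intro smooth_on_continuous_on_derivative[OF smooth_\<psi>] continuous_on_minus continuous_on_g_\<psi>)

lemma \<psi>_tendsto: "(p \<longlongrightarrow> w) F \<Longrightarrow> w \<in> V \<Longrightarrow> ((\<lambda>j. \<psi> (p j)) \<longlongrightarrow> \<psi> w) F"
  using continuous_on_\<psi> smooth_\<psi>
  by (metis continuous_on_eq_continuous_at isCont_tendsto_compose smooth_on_def)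

lemma g_tendsto: "(u \<longlongrightarrow> x) F \<Longrightarrow> x \<in> U \<Longrightarrow> ((\<lambda>j. g i (u j)) \<longlongrightarrow> g i x) F"
  using smooth_on_continuous_on[OF smooth_g] smooth_g
  by (metis continuous_on_eq_continuous_at isCont_tendsto_compose smooth_on_def)

text \<open>The chart expansion up to second order, with \<open>x = h \<kappa>\<close>.  The set \<open>Q\<close> is arbitrary so that the
  lemma applies both to the labels \<open>k h p\<close>, which stay in \<open>K\<close>, and to labels supplied by the
  surjectivity condition of a chart, which lie in some small ball.\<close>

lemma chart_label_remainder:
  fixes h :: "'j \<Rightarrow> real"
  assumes Q: "compact Q" "Q \<subseteq> U"
    and h: "(h \<longlongrightarrow> 0) F" "\<forall>\<^sub>F j in F. h j \<in> I"
    and lab: "\<forall>\<^sub>F j in F. h j *\<^sub>R real_vec (\<kappa> j) \<in> Q \<and> chart_label C G (h j) (p j) (\<kappa> j)"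
  shows "((\<lambda>j. (g 0 (h j *\<^sub>R real_vec (\<kappa> j)) - p j) /\<^sub>R h j
            + g 1 (h j *\<^sub>R real_vec (\<kappa> j))) \<longlongrightarrow> 0) F" (is "(?R \<longlongrightarrow> 0) F")
    and "((\<lambda>j. g 0 (h j *\<^sub>R real_vec (\<kappa> j)) - p j) \<longlongrightarrow> 0) F"
proof -
  let ?u = "\<lambda>j. h j *\<^sub>R real_vec (\<kappa> j)"
  obtain M h1 where h1: "h1 > 0" and M: "\<And>h x. h \<in> I \<Longrightarrow> h \<le> h1 \<Longrightarrow> x \<in> Q \<Longrightarrow>
      norm (G h x - (\<Sum>j\<le>1. h ^ j *\<^sub>R g j x)) \<le> M * h ^ 2"
  proof -
    have "smooth_expansion I U G g" using chart by (simp add: asymptotic_chart_def)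
    from this[unfolded smooth_expansion_def, THEN conjunct2, THEN conjunct2, rule_format, of Q "[]" 1]
    obtain M h1 where "h1 > 0" "\<forall>h\<in>I. h \<le> h1 \<longrightarrow> (\<forall>x\<in>Q.
        norm (partials [] (\<lambda>y. G h y - (\<Sum>j\<le>1. h ^ j *\<^sub>R g j y)) x) \<le> M * h ^ (1 + 1))"
      using Q by blast
    then show thesis unfolding partials.simps one_add_one using that by blast
  qed
  have small: "\<forall>\<^sub>F j in F. h j < h1" using order_tendstoD(2)[OF h(1) h1] .
  have bound: "\<forall>\<^sub>F j in F. norm (?R j) \<le> (M + C 2) * h j"
    using small h(2) lab
  proof eventually_elim
    case (elim j)
    have pos: "h j > 0" using I_pos elim by blast
    have 1: "norm (G (h j) (?u j) - (\<Sum>i\<le>1. h j ^ i *\<^sub>R g i (?u j))) \<le> M * h j ^ 2"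
      using M elim by auto
    have 2: "norm (p j - G (h j) (?u j)) \<le> C 2 * h j ^ 2"
      using elim by (auto simp: chart_label_def)
    have "h j *\<^sub>R ?R j = - (p j - G (h j) (?u j))
        - (G (h j) (?u j) - (\<Sum>i\<le>1. h j ^ i *\<^sub>R g i (?u j)))"
      using pos by (simp add: scaleR_add_right)
    also have "norm \<dots> \<le> (M + C 2) * h j ^ 2"
      using 1 2 norm_triangle_ineq4[of "- (p j - G (h j) (?u j))"
          "G (h j) (?u j) - (\<Sum>i\<le>1. h j ^ i *\<^sub>R g i (?u j))"]
      by (simp add: distrib_right norm_minus_commute)
    also have "norm (h j *\<^sub>R ?R j) = h j * norm (?R j)"
      unfolding norm_scaleR using pos by (simp only: abs_of_pos)
    also have "(M + C 2) * h j ^ 2 = h j * ((M + C 2) * h j)"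
      by (simp add: power2_eq_square)
    finally show ?case using pos by (simp only: mult_le_cancel_left_pos)
  qed
  have lim0: "((\<lambda>j. (M + C 2) * h j) \<longlongrightarrow> 0) F"
    using tendsto_mult_right_zero[OF h(1)] .
  show R: "(?R \<longlongrightarrow> 0) F"
    using bound lim0 by (rule Lim_null_comparison)
  obtain b where b: "\<And>x. x \<in> Q \<Longrightarrow> norm (g 1 x) \<le> b"
  proof -
    have "bounded (g 1 ` Q)"
      using compact_continuous_image[OF continuous_on_subset[OF smooth_on_continuous_on[OF smooth_g]]] Q
      by (blast intro: compact_imp_bounded)
    then show thesis using that by (auto simp: bounded_iff)
  qed
  have "((\<lambda>j. h j *\<^sub>R g 1 (?u j)) \<longlongrightarrow> 0) F"
  proof (rule Lim_null_comparison)
    show "\<forall>\<^sub>F j in F. norm (h j *\<^sub>R g 1 (?u j)) \<le> \<bar>h j\<bar> * b"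
      using lab by eventually_elim (auto intro!: mult_left_mono b[unfolded One_nat_def])
    show "((\<lambda>j. \<bar>h j\<bar> * b) \<longlongrightarrow> 0) F"
      by (rule tendsto_mult_left_zero) (use tendsto_rabs_zero[OF h(1)] in simp)
  qed
  moreover have "((\<lambda>j. h j *\<^sub>R ?R j) \<longlongrightarrow> 0) F"
    using tendsto_scaleR[OF h(1) R] by simp
  ultimately have "((\<lambda>j. h j *\<^sub>R ?R j - h j *\<^sub>R g 1 (?u j)) \<longlongrightarrow> 0 - 0) F"
    by (intro tendsto_diff)
  moreover have "\<forall>\<^sub>F j in F. h j *\<^sub>R ?R j - h j *\<^sub>R g 1 (?u j) = g 0 (?u j) - p j"
    using h(2)
  proof eventually_elim
    case (elim j)
    then have "h j \<noteq> 0" using I_pos by fastforce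
    then show ?case by (simp add: scaleR_add_right)
  qed
  ultimately show "((\<lambda>j. g 0 (?u j) - p j) \<longlongrightarrow> 0) F"
    using Lim_transform_eventually by force
qed

text \<open>With \<open>x = h \<kappa>\<close>, the remainder estimate says \<open>(g\<^sub>0(x) - p)/h \<rightarrow> - g\<^sub>1(\<psi>(w))\<close>; applying \<open>\<psi>\<close> to
  \<open>g\<^sub>0(x)\<close> and \<open>p\<close> turns this into the limit of \<open>(x - \<psi>(p))/h\<close>.\<close>

lemma chart_label_asymptotics:
  fixes h :: "'j \<Rightarrow> real"
  assumes Q: "compact Q" "Q \<subseteq> U"
    and h: "(h \<longlongrightarrow> 0) F" "\<forall>\<^sub>F j in F. h j \<in> I"
    and p: "(p \<longlongrightarrow> w) F" "w \<in> V"
    and lab: "\<forall>\<^sub>F j in F. h j *\<^sub>R real_vec (\<kappa> j) \<in> Q \<and> chart_label C G (h j) (p j) (\<kappa> j)"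
  shows "((\<lambda>j. real_vec (\<kappa> j) - \<psi> (p j) /\<^sub>R h j) \<longlongrightarrow> label_shift w) F"
proof -
  let ?u = "\<lambda>j. h j *\<^sub>R real_vec (\<kappa> j)"
  note rem = chart_label_remainder[OF Q h lab]
  have gu: "((\<lambda>j. g 0 (?u j)) \<longlongrightarrow> w) F"
    using tendsto_add[OF rem(2) p(1)] by simp
  have inv: "\<forall>\<^sub>F j in F. \<psi> (g 0 (?u j)) = ?u j"
    using lab Q(2) by (auto elim!: eventually_mono intro: \<psi>_g)
  have u: "(?u \<longlongrightarrow> \<psi> w) F"
    using Lim_transform_eventually[OF \<psi>_tendsto[OF gu p(2)] inv] .
  have "((\<lambda>j. g 1 (?u j)) \<longlongrightarrow> g 1 (\<psi> w)) F"
    using u \<psi>_in_U[OF p(2)] by (rule g_tendsto)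
  from tendsto_diff[OF rem(1) this]
  have "((\<lambda>j. (g 0 (?u j) - p j) /\<^sub>R h j) \<longlongrightarrow> - g 1 (\<psi> w)) F" by simp
  then have "((\<lambda>j. (\<psi> (g 0 (?u j)) - \<psi> (p j)) /\<^sub>R h j) \<longlongrightarrow> label_shift w) F"
    unfolding label_shift_def
    by (rule smooth_on_difference_quotient[OF smooth_\<psi> p(2) gu p(1)])
  moreover have "\<forall>\<^sub>F j in F. (\<psi> (g 0 (?u j)) - \<psi> (p j)) /\<^sub>R h j = real_vec (\<kappa> j) - \<psi> (p j) /\<^sub>R h j"
    using inv h(2)
  proof eventually_elim
    case (elim j)
    then have "h j \<noteq> 0" using I_pos by fastforce
    then show ?case using elim by (simp add: scaleR_diff_right)
  qed
  ultimately show ?thesis by (rule Lim_transform_eventually)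
qed

lemma label_asymptotics:
  fixes h :: "'j \<Rightarrow> real"
  assumes h: "(h \<longlongrightarrow> 0) F" "\<forall>\<^sub>F j in F. h j \<in> I"
    and p: "(p \<longlongrightarrow> w) F" "w \<in> V" "\<forall>\<^sub>F j in F. p j \<in> L (h j)"
  shows "((\<lambda>j. real_vec (k (h j) (p j)) - \<psi> (p j) /\<^sub>R h j) \<longlongrightarrow> label_shift w) F"
proof (rule chart_label_asymptotics[OF compact_K K_subset h p(1,2)])
  show "\<forall>\<^sub>F j in F. h j *\<^sub>R real_vec (k (h j) (p j)) \<in> K
      \<and> chart_label C G (h j) (p j) (k (h j) (p j))"
    using order_tendstoD(2)[OF h(1) h0_pos] h(2) p(3)
    by eventually_elim (use labels in auto)
qed

text \<open>A chart provides some point \<open>q h\<close> whose label may be taken to be \<open>\<kappa> h\<close>.  Both \<open>\<kappa> h\<close> and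
  the label \<open>k h (q h)\<close> obey the same asymptotics, so their difference is an integer vector that
  tends to zero.\<close>

lemma label_realised:
  assumes w: "w \<in> B"
    and \<kappa>: "((\<lambda>h. h *\<^sub>R real_vec (\<kappa> h)) \<longlongrightarrow> \<psi> w) (at 0 within I)" (is "(?u \<longlongrightarrow> _) ?F")
  obtains q where "(q \<longlongrightarrow> w) (at 0 within I)"
    "\<forall>\<^sub>F h in at 0 within I. q h \<in> L h \<and> k h (q h) = \<kappa> h"
proof -
  have wV: "w \<in> V" using w B_subset_V by blast
  let ?D = "{x \<in> U. g 0 x \<in> B}"
  have "open U" using smooth_g by (auto simp: smooth_on_def)
  have "?D = U \<inter> g 0 -` B" by auto
  then have "open ?D"
    using continuous_open_preimage[OF smooth_on_continuous_on[OF smooth_g] \<open>open U\<close> open_B]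
    by simp
  moreover have "\<psi> w \<in> ?D" using \<psi>_in_U[OF wV] g_\<psi>[OF wV] w by simp
  ultimately obtain r where r: "r > 0" "cball (\<psi> w) r \<subseteq> ?D"
    using open_contains_cball by blast
  obtain h1 where h1: "h1 > 0" "\<And>h \<kappa>. h \<in> I \<Longrightarrow> h \<le> h1 \<Longrightarrow> h *\<^sub>R real_vec \<kappa> \<in> ball (\<psi> w) r \<Longrightarrow>
      \<exists>p\<in>L h. chart_label C G h p \<kappa>"
  proof -
    have "\<exists>h0>0. \<forall>h\<in>I. h \<le> h0 \<longrightarrow>
        (\<forall>k. h *\<^sub>R real_vec k \<in> ball (\<psi> w) r \<longrightarrow> (\<exists>p\<in>L h. chart_label C G h p k))"
    proof -
      have "\<forall>W. open W \<and> compact (closure W) \<and> closure W \<subseteq> ?D \<longrightarrow>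
        (\<exists>h0>0. \<forall>h\<in>I. h \<le> h0 \<longrightarrow>
           (\<forall>k. h *\<^sub>R real_vec k \<in> W \<longrightarrow> (\<exists>p\<in>L h. chart_label C G h p k)))"
        using chart unfolding asymptotic_chart_def by (elim conjE)
      from spec[OF this, of "ball (\<psi> w) r"] show ?thesis
        using r by (simp only: open_ball closure_ball compact_cball simp_thms)
    qed
    then show thesis using that by blast
  qed
  define q where "q h = (SOME p. p \<in> L h \<and> chart_label C G h p (\<kappa> h))" for h
  have id: "((\<lambda>h::real. h) \<longlongrightarrow> 0) ?F" by (rule tendsto_ident_at)
  have q: "\<forall>\<^sub>F h in ?F. ?u h \<in> ball (\<psi> w) r \<and> q h \<in> L h \<and> chart_label C G h (q h) (\<kappa> h)"
    using eventually_in_I order_tendstoD(2)[OF id h1(1)] tendstoD[OF \<kappa> r(1)]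
  proof eventually_elim
    case (elim h)
    then have "\<exists>p. p \<in> L h \<and> chart_label C G h p (\<kappa> h)"
      using h1(2)[of h "\<kappa> h"] by (auto simp: dist_commute)
    from someI_ex[OF this] show ?case using elim by (auto simp: q_def dist_commute)
  qed
  have lab: "\<forall>\<^sub>F h in ?F. ?u h \<in> cball (\<psi> w) r \<and> chart_label C G h (q h) (\<kappa> h)"
    using q by eventually_elim auto
  have Q: "compact (cball (\<psi> w) r)" "cball (\<psi> w) r \<subseteq> U" using r by auto
  have "((\<lambda>h. g 0 (?u h)) \<longlongrightarrow> g 0 (\<psi> w)) ?F"
    using \<kappa> \<psi>_in_U[OF wV] by (rule g_tendsto)
  from tendsto_diff[OF this chart_label_remainder(2)[OF Q id eventually_in_I lab]]
  have qw: "(q \<longlongrightarrow> w) ?F" by (simp add: g_\<psi>[OF wV])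
  have "\<forall>\<^sub>F h in ?F. q h \<in> L h" using q by eventually_elim auto
  from tendsto_diff[OF label_asymptotics[OF id eventually_in_I qw wV this]
      chart_label_asymptotics[OF Q id eventually_in_I qw wV lab]]
  have "((\<lambda>h. real_vec (k h (q h) - \<kappa> h)) \<longlongrightarrow> 0) ?F"
    by (simp add: real_vec_diff)
  from real_vec_tendsto_imp_eventually_const[OF this at_0_within_I_nontrivial]
  obtain z where z: "0 = real_vec z" "\<forall>\<^sub>F h in ?F. k h (q h) - \<kappa> h = z" .
  have z0: "z = 0" using z(1) by (simp add: vec_eq_iff)
  have "\<forall>\<^sub>F h in ?F. q h \<in> L h \<and> k h (q h) = \<kappa> h"
    using z(2) q by eventually_elim (auto simp: z0)
  then show thesis using that qw by blast
qed

lemma all_labels_near: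
  assumes w: "w \<in> B"
  obtains \<kappa> where "\<And>a. \<exists>q. (q \<longlongrightarrow> w) (at 0 within I) \<and>
    (\<forall>\<^sub>F h in at 0 within I. q h \<in> L h \<and> k h (q h) = \<kappa> h + a)"
proof -
  have I: "I \<subseteq> {0<..}" using I_pos by auto
  show thesis
  proof (rule that)
    fix a
    show "\<exists>q. (q \<longlongrightarrow> w) (at 0 within I) \<and>
        (\<forall>\<^sub>F h in at 0 within I. q h \<in> L h \<and> k h (q h) = (\<chi> i. \<lfloor>\<psi> w $ i / h\<rfloor>) + a)"
      by (rule label_realised[OF w floor_vec_tendsto[OF I, of "\<psi> w" a]]) (intro exI conjI)
  qed
qed

end


section \<open>Absence of drift\<close>

text \<open>As \<open>1/h\<close> grows in small steps, \<open>m h\<close> cannot change its value.  The set of \<open>h\<close> at which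
  \<open>m h\<close> has the same value as at some starting point therefore accumulates at \<open>0\<close>: its infimum
  cannot be positive, because one more small step would lead below it.  On this set \<open>b/h\<close> stays
  bounded as \<open>h\<close> tends to \<open>0\<close>.\<close>

lemma hbar_continuous_imp_no_drift:
  fixes m :: "real \<Rightarrow> int"
  assumes cont: "hbar_continuous I" and I: "I \<subseteq> {0<..}" "0 islimpt I"
    and lim: "((\<lambda>h. real_of_int (m h) - b / h) \<longlongrightarrow> c) (at 0 within I)"
  shows "b = 0"
proof -
  \<comment> \<open>Two steps of size \<open>e\<close> in \<open>1/h\<close> change \<open>b/h\<close> by at most \<open>1/4\<close>; with two errors below \<open>1/4\<close>
    this still is less than the distance of two distinct integers.\<close>
  define e where "e = 1 / (8 * (\<bar>b\<bar> + 1))"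
  have e: "e > 0" "\<bar>b\<bar> * e \<le> 1/8" by (auto simp: e_def field_simps)
  obtain d1 where d1: "d1 > 0" "\<And>h. h \<in> I \<Longrightarrow> h < d1 \<Longrightarrow> \<bar>real_of_int (m h) - b / h - c\<bar> < 1/4"
  proof -
    have "\<forall>\<^sub>F h in at 0 within I. dist (real_of_int (m h) - b / h) c < 1/4"
      using lim by (rule tendstoD) simp
    then obtain d where "d > 0" "\<forall>h\<in>I. h \<noteq> 0 \<and> dist h 0 < d \<longrightarrow> dist (real_of_int (m h) - b / h) c < 1/4"
      unfolding eventually_at by blast
    then show thesis using I(1) that[of d] by (force simp: dist_real_def)
  qed
  obtain d2 where d2: "d2 > 0" "\<And>h1. h1 \<in> closure I - {0} \<Longrightarrow> h1 < d2 \<Longrightarrow>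
      \<exists>h2\<in>I. h2 < h1 \<and> 1 / h2 - 1 / h1 < e"
    using cont e(1) unfolding hbar_continuous_def by blast
  have "min d1 d2 > 0" using d1(1) d2(1) by simp
  then obtain h1 where "h1 \<in> I" "dist h1 0 < min d1 d2"
    using I(2) unfolding islimpt_approachable by blast
  then have h1: "h1 \<in> I" "h1 < min d1 d2" by (auto simp: dist_real_def)
  define S where "S = {h \<in> I. h \<le> h1 \<and> m h = m h1}"
  have h1S: "h1 \<in> S" using h1 by (simp add: S_def)
  have S_pos: "h > 0" if "h \<in> S" for h using that I(1) by (auto simp: S_def)
  have bdd: "bdd_below S" using S_pos by (meson bdd_belowI less_imp_le)
  have "Inf S \<le> 0"
  proof (rule ccontr)
    assume "\<not> Inf S \<le> 0"
    define s where "s = Inf S"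
    have s: "s > 0" "s \<le> h1" using \<open>\<not> Inf S \<le> 0\<close> h1S bdd by (auto simp: s_def intro: cInf_lower)
    have "s \<in> closure S" unfolding s_def using h1S bdd by (intro closure_contains_Inf) auto
    then have "s \<in> closure I - {0}"
      using closure_mono[of S I] s(1) by (auto simp: S_def)
    then obtain h2 where h2: "h2 \<in> I" "h2 < s" "1 / h2 - 1 / s < e"
      using d2(2)[of s] s(2) h1(2) by auto
    have "((\<lambda>x. 1 / x) \<longlongrightarrow> 1 / s) (at s)"
      using s(1) by (auto intro!: tendsto_eq_intros)
    then have "\<forall>\<^sub>F x in at s. dist (1 / x) (1 / s) < e"
      using e(1) by (rule tendstoD)
    then obtain r where r: "r > 0" "\<And>x. x \<noteq> s \<Longrightarrow> dist x s < r \<Longrightarrow> dist (1 / x) (1 / s) < e"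
      unfolding eventually_at by auto
    obtain h3 where h3: "h3 \<in> S" "dist h3 s < r"
      using \<open>s \<in> closure S\<close> r(1) unfolding closure_approachable by blast
    have "dist (1 / h3) (1 / s) < e" using r(2)[of h3] h3(2) e(1) by (cases "h3 = s") auto
    moreover have "1 / s < 1 / h2" using h2 s I(1) by (auto intro!: divide_strict_left_mono)
    ultimately have "\<bar>1 / h2 - 1 / h3\<bar> \<le> 2 * e" using h2(3) by (auto simp: dist_real_def)
    then have "\<bar>b\<bar> * \<bar>1 / h2 - 1 / h3\<bar> \<le> \<bar>b\<bar> * (2 * e)" by (rule mult_left_mono) simp
    then have "\<bar>b / h2 - b / h3\<bar> \<le> 1/4"
      using e(2) by (simp add: abs_mult[symmetric] right_diff_distrib)
    moreover have "\<bar>real_of_int (m h2) - b / h2 - c\<bar> < 1/4"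
      using d1(2)[of h2] h2 s(2) h1(2) by auto
    moreover have "\<bar>real_of_int (m h3) - b / h3 - c\<bar> < 1/4"
      using d1(2)[of h3] h3(1) h1(2) by (auto simp: S_def)
    ultimately have "\<bar>real_of_int (m h2) - real_of_int (m h3)\<bar> < 1" by linarith
    then have "m h2 = m h3" by linarith
    then have "h2 \<in> S" using h2 h3(1) s(2) by (auto simp: S_def)
    then have "s \<le> h2" using bdd by (auto simp: s_def intro: cInf_lower)
    then show False using h2(2) by simp
  qed
  define M where "M = \<bar>real_of_int (m h1)\<bar> + \<bar>c\<bar> + 1"
  have M: "M > 0" by (simp add: M_def add_nonneg_pos)
  have bound: "\<bar>b\<bar> \<le> h * M" if "h \<in> S" for h
  proof -
    have "\<bar>real_of_int (m h1) - b / h - c\<bar> < 1/4"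
      using d1(2)[of h] that h1(2) by (auto simp: S_def)
    then have "\<bar>b / h\<bar> \<le> M" unfolding M_def by linarith
    then show ?thesis using S_pos[OF that] by (simp add: field_simps)
  qed
  show "b = 0"
  proof (rule ccontr)
    assume "b \<noteq> 0"
    then have "\<bar>b\<bar> / M > 0" using M by simp
    then obtain h where "h \<in> S" "h < \<bar>b\<bar> / M"
      using \<open>Inf S \<le> 0\<close> h1S bdd by (metis cInf_less_iff empty_iff order_le_less_trans)
    then show False using bound[of h] M by (simp add: field_simps)
  qed
qed

section \<open>Comparison of two labellings\<close>

locale labelled_chart_pair =
  a: labelled_chart L I B U V G g C K k h0 + b: labelled_chart L I B U' V' G' g' C' K' k' h0'
  for L :: "real \<Rightarrow> (real^'n) set" and I :: "real set" and B :: "(real^'n) set"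
    and U V G g C K k h0 U' V' G' g' C' K' k' h0'
begin

text \<open>The differential of \<open>\<psi>' \<circ> g\<^sub>0\<close>, the change of coordinates between the charts to
  leading order, at the point \<open>\<psi>(p)\<close>.\<close>

definition transition :: "real^'n \<Rightarrow> real^'n \<Rightarrow> real^'n" where
  "transition p v = frechet_derivative b.\<psi> (at p) (frechet_derivative (g 0) (at (a.\<psi> p)) v)"

lemma linear_transition:
  assumes "p \<in> B"
  shows "linear (transition p)"
proof -
  have "linear (frechet_derivative (g 0) (at (a.\<psi> p)))"
    using smooth_on_has_derivative[OF a.smooth_g a.\<psi>_in_U] assms a.B_subset_V has_derivative_linear
    by blast
  moreover have "linear (frechet_derivative b.\<psi> (at p))"
    using smooth_on_has_derivative[OF b.smooth_\<psi>] assms b.B_subset_V has_derivative_linear by blast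
  ultimately show ?thesis
    using linear_compose unfolding transition_def[abs_def] comp_def by blast
qed

text \<open>Two points of \<open>L h\<close> that tend to \<open>p\<close> and whose \<open>k\<close>-labels differ by \<open>axis i 1\<close> have \<open>k'\<close>-labels
  whose difference is integral and tends to \<open>transition p (axis i 1)\<close>: in both differences the
  constant terms of the label asymptotics cancel.\<close>

lemma transition_integral:
  assumes p: "p \<in> B"
  shows "\<exists>z. transition p (axis i 1) = real_vec z"
proof -
  let ?F = "at 0 within I"
  have pV: "p \<in> V" "p \<in> V'" using p a.B_subset_V b.B_subset_V by auto
  obtain \<kappa> where \<kappa>: "\<And>a. \<exists>q. (q \<longlongrightarrow> p) ?F \<and> (\<forall>\<^sub>F h in ?F. q h \<in> L h \<and> k h (q h) = \<kappa> h + a)"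
    using a.all_labels_near[OF p] by blast
  obtain q where q: "(q \<longlongrightarrow> p) ?F" "\<forall>\<^sub>F h in ?F. q h \<in> L h" "\<forall>\<^sub>F h in ?F. k h (q h) = \<kappa> h + 0"
    using \<kappa>[of 0] unfolding eventually_conj_iff by blast
  obtain r where r: "(r \<longlongrightarrow> p) ?F" "\<forall>\<^sub>F h in ?F. r h \<in> L h" "\<forall>\<^sub>F h in ?F. k h (r h) = \<kappa> h + axis i 1"
    using \<kappa>[of "axis i 1"] unfolding eventually_conj_iff by blast
  have id: "((\<lambda>h::real. h) \<longlongrightarrow> 0) ?F" by (rule tendsto_ident_at)
  have "((\<lambda>h. real_vec (k h (r h) - k h (q h))) \<longlongrightarrow> axis i 1) ?F"
    by (rule tendsto_eventually)
       (use q(3) r(3) in eventually_elim, simp add: real_vec_axis)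
  from tendsto_diff[OF this tendsto_diff[OF
        a.label_asymptotics[OF id a.eventually_in_I r(1) pV(1) r(2)]
        a.label_asymptotics[OF id a.eventually_in_I q(1) pV(1) q(2)]]]
  have "((\<lambda>h. (a.\<psi> (r h) - a.\<psi> (q h)) /\<^sub>R h) \<longlongrightarrow> axis i 1) ?F"
    by (simp add: real_vec_diff scaleR_diff_right algebra_simps)
  from smooth_on_difference_quotient[OF a.smooth_g[of 0] a.\<psi>_in_U[OF pV(1)]
      a.\<psi>_tendsto[OF r(1) pV(1)] a.\<psi>_tendsto[OF q(1) pV(1)] this]
  have "((\<lambda>h. (g 0 (a.\<psi> (r h)) - g 0 (a.\<psi> (q h))) /\<^sub>R h)
      \<longlongrightarrow> frechet_derivative (g 0) (at (a.\<psi> p)) (axis i 1)) ?F" .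
  moreover have "\<forall>\<^sub>F h in ?F. (g 0 (a.\<psi> (r h)) - g 0 (a.\<psi> (q h))) /\<^sub>R h = (r h - q h) /\<^sub>R h"
    using q(2) r(2) a.eventually_in_I
  proof eventually_elim
    case (elim h)
    then have "r h \<in> V" "q h \<in> V" using a.L_subset_B a.B_subset_V by blast+
    then show ?case by (simp add: a.g_\<psi>)
  qed
  ultimately have "((\<lambda>h. (r h - q h) /\<^sub>R h)
      \<longlongrightarrow> frechet_derivative (g 0) (at (a.\<psi> p)) (axis i 1)) ?F"
    by (rule Lim_transform_eventually)
  from smooth_on_difference_quotient[OF b.smooth_\<psi> pV(2) r(1) q(1) this]
  have "((\<lambda>h. (b.\<psi> (r h) - b.\<psi> (q h)) /\<^sub>R h) \<longlongrightarrow> transition p (axis i 1)) ?F"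
    by (simp add: transition_def)
  from tendsto_add[OF this tendsto_diff[OF
        b.label_asymptotics[OF id a.eventually_in_I r(1) pV(2) r(2)]
        b.label_asymptotics[OF id a.eventually_in_I q(1) pV(2) q(2)]]]
  have "((\<lambda>h. real_vec (k' h (r h) - k' h (q h))) \<longlongrightarrow> transition p (axis i 1)) ?F"
    by (simp add: real_vec_diff scaleR_diff_right algebra_simps)
  from real_vec_tendsto_imp_eventually_const[OF this a.at_0_within_I_nontrivial]
  show ?thesis by blast
qed

lemma transition_constant:
  assumes "p \<in> B" "q \<in> B"
  shows "transition p (axis i 1) = transition q (axis i 1)"
proof (rule constant_if_integral_differences[OF a.connected_B _ _ assms])
  have "continuous_on V (\<lambda>p. frechet_derivative (g 0) (at (a.\<psi> p)) (axis i 1))"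
    by (rule continuous_on_compose2[OF smooth_on_continuous_on_derivative[OF a.smooth_g
          continuous_on_const] a.continuous_on_\<psi>]) (use a.\<psi>_in_U in auto)
  then have "continuous_on (V \<inter> V') (\<lambda>p. frechet_derivative (g 0) (at (a.\<psi> p)) (axis i 1))"
    by (rule continuous_on_subset) simp
  moreover have "smooth_on (V \<inter> V') b.\<psi>"
    using b.smooth_\<psi> a.smooth_\<psi> by (auto simp: smooth_on_def)
  ultimately have "continuous_on (V \<inter> V') (\<lambda>p. transition p (axis i 1))"
    unfolding transition_def by (intro smooth_on_continuous_on_derivative)
  then show "continuous_on B (\<lambda>p. transition p (axis i 1))"
    using a.B_subset_V b.B_subset_V by (auto intro: continuous_on_subset)
  show "\<exists>z. transition x (axis i 1) - transition y (axis i 1) = real_vec z"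
    if "x \<in> B" "y \<in> B" for x y
    using transition_integral[OF that(1)] transition_integral[OF that(2)]
    by (metis real_vec_diff)
qed

lemma transition_matrix:
  obtains A :: "int^'n^'n" where "\<And>p v. p \<in> B \<Longrightarrow> transition p v = map_matrix real_of_int A *v v"
proof -
  obtain p0 where p0: "p0 \<in> B" using a.B_nonempty by blast
  obtain z where z: "\<And>i. transition p0 (axis i 1) = real_vec (z i)"
    using transition_integral[OF p0] by metis
  define A :: "int^'n^'n" where "A = (\<chi> i j. z j $ i)"
  have "transition p v = map_matrix real_of_int A *v v" if p: "p \<in> B" for p v
  proof -
    have "column i (matrix (transition p)) = column i (map_matrix real_of_int A)" for i
      using transition_constant[OF p p0, of i] z[of i]
      by (simp add: column_def matrix_def A_def vec_eq_iff)
    then have "matrix (transition p) = map_matrix real_of_int A"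
      by (simp add: column_def vec_eq_iff)
    then show ?thesis using fun_cong[OF matrix_vector_mul(2)[OF linear_transition[OF p]], of v] by simp
  qed
  then show thesis using that by blast
qed

lemma det_transition_pos:
  assumes p: "p \<in> B"
  shows "det (matrix (transition p)) > 0"
proof -
  let ?Dg = "frechet_derivative (g 0) (at (a.\<psi> p))"
  let ?D\<psi> = "frechet_derivative b.\<psi> (at p)"
  let ?Dg' = "frechet_derivative (g' 0) (at (b.\<psi> p))"
  have pV: "p \<in> V" "p \<in> V'" using p a.B_subset_V b.B_subset_V by auto
  have lin: "linear ?Dg" "linear ?D\<psi>" "linear ?Dg'"
    using smooth_on_has_derivative[OF a.smooth_g a.\<psi>_in_U[OF pV(1)]]
      smooth_on_has_derivative[OF b.smooth_\<psi> pV(2)]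
      smooth_on_has_derivative[OF b.smooth_g b.\<psi>_in_U[OF pV(2)]] has_derivative_linear by blast+
  have "det (matrix ?Dg) > 0"
    using a.diffeo a.\<psi>_in_U[OF pV(1)]
    by (simp add: orientation_preserving_diffeo_def jacobian_def)
  moreover have "det (matrix ?D\<psi>) > 0"
  proof -
    have pos: "det (matrix ?Dg') > 0"
      using b.diffeo b.\<psi>_in_U[OF pV(2)]
      by (simp add: orientation_preserving_diffeo_def jacobian_def)
    have "?Dg' \<circ> ?D\<psi> = id"
      using derivative_left_inverse[OF b.smooth_\<psi> b.smooth_g pV(2) b.\<psi>_in_U[OF pV(2)] b.g_\<psi>]
      by (simp add: fun_eq_iff)
    then have "matrix ?Dg' ** matrix ?D\<psi> = mat 1"
      using matrix_compose[OF lin(2,3)] by (simp add: matrix_id_mat_1)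
    then have "det (matrix ?Dg') * det (matrix ?D\<psi>) = 1"
      by (metis det_I det_mul)
    then show ?thesis using pos by (metis zero_less_mult_pos zero_less_one)
  qed
  moreover have "transition p = ?D\<psi> \<circ> ?Dg"
    by (simp add: fun_eq_iff transition_def)
  ultimately show ?thesis using matrix_compose[OF lin(1,2)] by (simp add: det_mul)
qed

text \<open>The roles of the two labellings are symmetric, so the inverse matrix is integral too and the
  determinant is a unit of \<open>\<int>\<close>.\<close>

lemma transition_matrix_SL:
  obtains A :: "int^'n^'n" where "det A = 1"
    "\<And>p v. p \<in> B \<Longrightarrow> transition p v = map_matrix real_of_int A *v v"
proof -
  interpret sw: labelled_chart_pair L I B U' V' G' g' C' K' k' h0' U V G g C K k h0 ..
  obtain A where A: "\<And>p v. p \<in> B \<Longrightarrow> transition p v = map_matrix real_of_int A *v v"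
    using transition_matrix by blast
  obtain A' where A': "\<And>p v. p \<in> B \<Longrightarrow> sw.transition p v = map_matrix real_of_int A' *v v"
    using sw.transition_matrix by blast
  obtain p where p: "p \<in> B" using a.B_nonempty by blast
  have pV: "p \<in> V" "p \<in> V'" using p a.B_subset_V b.B_subset_V by auto
  have inv: "sw.transition p (transition p v) = v" for v
    using derivative_left_inverse[OF b.smooth_\<psi> b.smooth_g[of 0] pV(2) b.\<psi>_in_U[OF pV(2)] b.g_\<psi>]
      derivative_left_inverse[OF a.smooth_g[of 0] a.smooth_\<psi> a.\<psi>_in_U[OF pV(1)] _ a.\<psi>_g]
    by (simp add: transition_def sw.transition_def a.g_\<psi>[OF pV(1)] pV)
  have "(map_matrix real_of_int A' ** map_matrix real_of_int A) *v v = mat 1 *v v" for v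
    using inv[of v] by (simp add: A[OF p] A'[OF p] matrix_vector_mul_assoc)
  then have "map_matrix real_of_int A' ** map_matrix real_of_int A = mat 1"
    by (simp add: matrix_eq)
  then have "real_of_int (det A') * real_of_int (det A) = 1"
    by (metis det_I det_mul det_map_matrix_of_int)
  then have "det A' * det A = 1"
    by (metis of_int_eq_1_iff of_int_mult)
  moreover have "det A > 0"
  proof -
    have "matrix (transition p) = map_matrix real_of_int A"
      using A[OF p] fun_cong[OF matrix_vector_mul(2)[OF linear_transition[OF p]]]
      by (simp add: matrix_eq)
    then show ?thesis
      using det_transition_pos[OF p] by (simp add: det_map_matrix_of_int)
  qed
  ultimately have "det A = 1" using pos_zmult_eq_1_iff by (metis mult.commute)
  then show thesis using A that by blast
qed

text \<open>Composed with \<open>D\<psi>\<close>, the hypothesis says \<open>D\<psi>' = A D\<psi>\<close>.\<close>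

lemma inverse_charts_affine:
  assumes A: "\<And>p v. p \<in> B \<Longrightarrow> transition p v = A *v v"
  obtains b where "\<And>p. p \<in> B \<Longrightarrow> b.\<psi> p = A *v a.\<psi> p + b"
proof -
  let ?f = "\<lambda>p. b.\<psi> p - A *v a.\<psi> p"
  have const: "?f p = ?f q" if "p \<in> B" "q \<in> B" for p q
  proof (rule has_derivative_zero_unique_connected[OF a.open_B a.connected_B _ that])
    fix p assume p: "p \<in> B"
    then have pV: "p \<in> V" "p \<in> V'" using a.B_subset_V b.B_subset_V by auto
    have "(?f has_derivative (\<lambda>v. frechet_derivative b.\<psi> (at p) v
        - A *v frechet_derivative a.\<psi> (at p) v)) (at p)"
      using smooth_on_has_derivative[OF a.smooth_\<psi> pV(1)] smooth_on_has_derivative[OF b.smooth_\<psi> pV(2)]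
      by (intro has_derivative_diff bounded_linear.has_derivative[OF matrix_vector_mul_bounded_linear])
    moreover have "A *v frechet_derivative a.\<psi> (at p) v = frechet_derivative b.\<psi> (at p) v" for v
      using derivative_left_inverse[OF a.smooth_\<psi> a.smooth_g[of 0] pV(1) a.\<psi>_in_U[OF pV(1)] a.g_\<psi>]
      by (simp add: A[OF p, symmetric] transition_def)
    ultimately show "(?f has_derivative (\<lambda>v. 0)) (at p)" by simp
  qed
  obtain p0 where "p0 \<in> B" using a.B_nonempty by blast
  from const[OF _ this] show thesis by (intro that[of "?f p0"]) (simp add: algebra_simps)
qed

text \<open>The constant term of \<open>k' - A k\<close>.\<close>

definition shift :: "int^'n^'n \<Rightarrow> real^'n \<Rightarrow> real^'n" where
  "shift A p = b.label_shift p - map_matrix real_of_int A *v a.label_shift p"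

text \<open>The affine relation is applied at the points \<open>p j\<close>, which lie in \<open>B\<close>; their limit \<open>w\<close>
  may be on the boundary.\<close>

lemma label_difference_asymptotics:
  fixes h :: "'j \<Rightarrow> real"
  assumes affine: "\<And>p. p \<in> B \<Longrightarrow> b.\<psi> p = map_matrix real_of_int A *v a.\<psi> p + b"
    and h: "(h \<longlongrightarrow> 0) F" "\<forall>\<^sub>F j in F. h j \<in> I"
    and p: "(p \<longlongrightarrow> w) F" "w \<in> closure B" "\<forall>\<^sub>F j in F. p j \<in> L (h j)"
  shows "((\<lambda>j. real_vec (k' (h j) (p j) - A *v k (h j) (p j)) - b /\<^sub>R h j) \<longlongrightarrow> shift A w) F"
proof -
  have w: "w \<in> V" "w \<in> V'" using p(2) a.closure_B b.closure_B by auto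
  have "((\<lambda>j. real_vec (k' (h j) (p j)) - b.\<psi> (p j) /\<^sub>R h j
      - map_matrix real_of_int A *v (real_vec (k (h j) (p j)) - a.\<psi> (p j) /\<^sub>R h j)) \<longlongrightarrow> shift A w) F"
    unfolding shift_def
    by (intro tendsto_diff b.label_asymptotics[OF h p(1) w(2) p(3)]
        bounded_linear.tendsto[OF matrix_vector_mul_bounded_linear]
        a.label_asymptotics[OF h p(1) w(1) p(3)])
  moreover have "\<forall>\<^sub>F j in F. real_vec (k' (h j) (p j)) - b.\<psi> (p j) /\<^sub>R h j
      - map_matrix real_of_int A *v (real_vec (k (h j) (p j)) - a.\<psi> (p j) /\<^sub>R h j)
      = real_vec (k' (h j) (p j) - A *v k (h j) (p j)) - b /\<^sub>R h j"
    using h(2) p(3)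
  proof eventually_elim
    case (elim j)
    then have "p j \<in> B" using a.L_subset_B by blast
    then show ?case
      by (simp add: affine real_vec_diff real_vec_matrix_vector_mult matrix_vector_mult_diff_distrib
          matrix_vector_mult_scaleR scaleR_add_right)
  qed
  ultimately show ?thesis by (rule Lim_transform_eventually)
qed

lemma exists_affine_relabelling:
  assumes cont: "hbar_continuous I"
  shows "\<exists>\<tau>\<in>GA_plus. \<exists>h0>0. \<forall>h\<in>I. h \<le> h0 \<longrightarrow> (\<forall>p\<in>L h. k' h p = \<tau> (k h p))"
proof -
  let ?F = "at 0 within I"
  obtain A where A: "det A = 1" "\<And>p v. p \<in> B \<Longrightarrow> transition p v = map_matrix real_of_int A *v v"
    using transition_matrix_SL by blast
  obtain b where b: "\<And>p. p \<in> B \<Longrightarrow> b.\<psi> p = map_matrix real_of_int A *v a.\<psi> p + b"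
    using inverse_charts_affine[OF A(2)] by blast
  have id: "((\<lambda>h::real. h) \<longlongrightarrow> 0) ?F" by (rule tendsto_ident_at)
  have near: "\<exists>m. ((\<lambda>h. real_vec (m h) - b /\<^sub>R h) \<longlongrightarrow> shift A p) ?F" if p: "p \<in> B" for p
  proof -
    obtain \<kappa> where \<kappa>: "\<And>a. \<exists>q. (q \<longlongrightarrow> p) ?F \<and> (\<forall>\<^sub>F h in ?F. q h \<in> L h \<and> k h (q h) = \<kappa> h + a)"
      using a.all_labels_near[OF p] by blast
    then obtain q where q: "(q \<longlongrightarrow> p) ?F" "\<forall>\<^sub>F h in ?F. q h \<in> L h"
      unfolding eventually_conj_iff by blast
    have "p \<in> closure B" using p closure_subset by blast
    then have "((\<lambda>h. real_vec (k' h (q h) - A *v k h (q h)) - b /\<^sub>R h) \<longlongrightarrow> shift A p) ?F"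
      by (intro label_difference_asymptotics[OF b id a.eventually_in_I q(1) _ q(2)])
    then show ?thesis by (rule exI[of _ "\<lambda>h. k' h (q h) - A *v k h (q h)"])
  qed
  obtain w where w: "w \<in> B" using a.B_nonempty by blast
  obtain m where m: "((\<lambda>h. real_vec (m h) - b /\<^sub>R h) \<longlongrightarrow> shift A w) ?F"
    using near[OF w] by blast
  have "b $ i = 0" for i
  proof (rule hbar_continuous_imp_no_drift[OF cont])
    show "I \<subseteq> {0<..}" "0 islimpt I"
      using a.lattice by (auto simp: asymptotic_lattice_def)
    show "((\<lambda>h. real_of_int (m h $ i) - b $ i / h) \<longlongrightarrow> shift A w $ i) ?F"
      using tendsto_vec_nth[OF m, of i] by (simp add: divide_inverse mult.commute)
  qed
  then have b0: "b = 0" by (simp add: vec_eq_iff)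
  have shift_int: "\<exists>z. shift A p = real_vec z" if p: "p \<in> B" for p
  proof -
    obtain m where "((\<lambda>h. real_vec (m h)) \<longlongrightarrow> shift A p) ?F" using near[OF p] b0 by auto
    then show ?thesis
      by (rule real_vec_tendsto_imp_eventually_const[OF _ a.at_0_within_I_nontrivial]) (rule exI)
  qed
  obtain l where l: "shift A w = real_vec l" using shift_int[OF w] by blast
  have shift_cont: "continuous_on (closure B) (shift A)"
    unfolding shift_def[abs_def] using a.closure_B b.closure_B
    by (intro continuous_on_diff bounded_linear.continuous_on[OF matrix_vector_mul_bounded_linear]
        continuous_on_subset[OF a.continuous_on_label_shift]
        continuous_on_subset[OF b.continuous_on_label_shift])
  have "shift A p = real_vec l" if p: "p \<in> B" for p
    unfolding l[symmetric]
  proof (rule constant_if_integral_differences[OF a.connected_B _ _ p w])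
    show "continuous_on B (shift A)"
      using shift_cont closure_subset by (rule continuous_on_subset)
    show "\<exists>z. shift A x - shift A y = real_vec z" if "x \<in> B" "y \<in> B" for x y
      using shift_int[OF that(1)] shift_int[OF that(2)] by (metis real_vec_diff)
  qed
  then have shift_l: "shift A p = real_vec l" if "p \<in> closure B" for p
    using continuous_constant_on_closure[OF shift_cont _ that] by blast
  define \<tau> where "\<tau> = (\<lambda>a. A *v a + l)"
  have "\<exists>h0>0. \<forall>h\<in>I. h \<le> h0 \<longrightarrow> (\<forall>p\<in>L h. k' h p = \<tau> (k h p))"
  proof (rule ccontr)
    assume neg: "\<not> ?thesis"
    \<comment> \<open>Counterexamples for a sequence of \<open>h\<close> tending to \<open>0\<close> accumulate at some \<open>u\<close> in \<open>closure B\<close>,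
      where the label difference converges to \<open>l\<close>.\<close>
    have "\<exists>h p. h \<in> I \<and> h \<le> inverse (real (Suc n)) \<and> p \<in> L h \<and> k' h p \<noteq> \<tau> (k h p)" for n
      using neg by (metis inverse_positive_iff_positive of_nat_0_less_iff zero_less_Suc)
    then obtain h p where hp: "\<And>n. h n \<in> I" "\<And>n. h n \<le> inverse (real (Suc n))"
        "\<And>n. p n \<in> L (h n)" "\<And>n. k' (h n) (p n) \<noteq> \<tau> (k (h n) (p n))"
      by metis
    have h: "h \<longlonglongrightarrow> 0"
    proof (rule tendsto_sandwich[OF _ _ tendsto_const LIMSEQ_inverse_real_of_nat])
      show "\<forall>\<^sub>F n in sequentially. 0 \<le> h n" using a.I_pos hp(1) by (simp add: less_imp_le)
      show "\<forall>\<^sub>F n in sequentially. h n \<le> inverse (real (Suc n))"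
        using hp(2) by (rule always_eventually[OF allI])
    qed
    have "compact (closure B)" using a.bounded_B by simp
    moreover have "\<forall>n. p n \<in> closure B" using hp(1,3) a.L_subset_B closure_subset by blast
    ultimately obtain u r where ur: "u \<in> closure B" "strict_mono (r :: nat \<Rightarrow> nat)" "(p \<circ> r) \<longlonglongrightarrow> u"
      using compact_imp_seq_compact seq_compactE by metis
    have "(\<lambda>n. real_vec (k' ((h \<circ> r) n) ((p \<circ> r) n) - A *v k ((h \<circ> r) n) ((p \<circ> r) n))
        - b /\<^sub>R (h \<circ> r) n) \<longlonglongrightarrow> shift A u"
      using LIMSEQ_subseq_LIMSEQ[OF h ur(2)] hp ur(1,3)
      by (intro label_difference_asymptotics[OF b]) (auto simp: comp_def)
    then have "(\<lambda>n. real_vec (k' (h (r n)) (p (r n)) - A *v k (h (r n)) (p (r n)))) \<longlonglongrightarrow> real_vec l"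
      using shift_l[OF ur(1)] b0 by simp
    then obtain z where z: "real_vec l = real_vec z"
        "\<forall>\<^sub>F n in sequentially. k' (h (r n)) (p (r n)) - A *v k (h (r n)) (p (r n)) = z"
      by (rule real_vec_tendsto_imp_eventually_const[OF _ sequentially_bot])
    from z(2) obtain n where "k' (h (r n)) (p (r n)) - A *v k (h (r n)) (p (r n)) = l"
      using z(1) eventually_happens'[OF sequentially_bot] by auto
    then have "k' (h (r n)) (p (r n)) = \<tau> (k (h (r n)) (p (r n)))"
      by (simp add: \<tau>_def algebra_simps)
    then show False using hp(4) by blast
  qed
  moreover have "\<tau> \<in> GA_plus" using A(1) by (auto simp: GA_plus_def \<tau>_def)
  ultimately show ?thesis by blast
qed

end

section \<open>Existence and uniqueness of the relabelling\<close>

text \<open>For small \<open>h\<close>, the labels include some \<open>\<kappa> h\<close> and all its neighbours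
  \<open>\<kappa> h + axis i 1\<close>, an affine frame of \<open>\<int>\<^sup>n\<close>.\<close>

lemma (in labelled_chart) affine_maps_eq_if_agree_on_labels:
  assumes \<tau>: "\<tau> \<in> GA_plus" "\<tau>' \<in> GA_plus"
    and agree: "\<forall>\<^sub>F h in at 0 within I. \<forall>p\<in>L h. \<tau> (k h p) = \<tau>' (k h p)"
  shows "\<tau> = \<tau>'"
proof -
  obtain A l A' l' where eq: "\<tau> = (\<lambda>a. A *v a + l)" "\<tau>' = (\<lambda>a. A' *v a + l')"
    using \<tau> by (auto simp: GA_plus_def)
  obtain w where w: "w \<in> B" using B_nonempty by blast
  obtain \<kappa> where \<kappa>: "\<And>a. \<exists>q. (q \<longlongrightarrow> w) (at 0 within I) \<and>
      (\<forall>\<^sub>F h in at 0 within I. q h \<in> L h \<and> k h (q h) = \<kappa> h + a)"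
    using all_labels_near[OF w] by blast
  have ev: "\<forall>\<^sub>F h in at 0 within I. \<tau> (\<kappa> h + a) = \<tau>' (\<kappa> h + a)" for a
  proof -
    obtain q where "\<forall>\<^sub>F h in at 0 within I. q h \<in> L h \<and> k h (q h) = \<kappa> h + a" using \<kappa> by blast
    with agree show ?thesis by eventually_elim metis
  qed
  have "\<forall>\<^sub>F h in at 0 within I. \<tau> (\<kappa> h + 0) = \<tau>' (\<kappa> h + 0)
      \<and> (\<forall>i. \<tau> (\<kappa> h + axis i 1) = \<tau>' (\<kappa> h + axis i 1))"
    by (intro eventually_conj eventually_all_finite ev)
  then obtain a where a: "\<tau> (a + 0) = \<tau>' (a + 0)" "\<And>i. \<tau> (a + axis i 1) = \<tau>' (a + axis i 1)"
    using eventually_happens'[OF at_0_within_I_nontrivial] by blast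
  have "A *v axis i 1 = A' *v axis i 1" for i
  proof -
    have "(A *v a + l) + A *v axis i 1 = (A' *v a + l') + A' *v axis i 1"
      using a(2)[of i] by (simp add: eq matrix_vector_right_distrib algebra_simps)
    then show ?thesis using a(1) by (simp add: eq)
  qed
  moreover have "(M *v axis i 1) $ j = M $ j $ i" for M :: "int^'n^'n" and i j
    by (simp add: matrix_vector_mult_def axis_def if_distrib cong: if_cong)
  ultimately have "A = A'" by (metis vec_eq_iff)
  then show ?thesis using a(1) by (simp add: eq)
qed

lemma good_labelling_imp_labelled_chart:
  assumes "asymptotic_lattice L I B" "good_labelling L I B k"
  obtains U V G g C K h0 where "labelled_chart L I B U V G g C K k h0"
proof -
  obtain U G g C K h0 where c: "asymptotic_chart L I B U G g C" "compact K" "K \<subseteq> U" "h0 > 0"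
    "\<forall>h\<in>I. h \<le> h0 \<longrightarrow> (\<forall>p\<in>L h. h *\<^sub>R real_vec (k h p) \<in> K \<and> chart_label C G h p (k h p))"
    using assms(2) unfolding good_labelling_def by blast
  obtain V where "closure B \<subseteq> V" "orientation_preserving_diffeo U V (g 0)"
    using c(1) by (auto simp: asymptotic_chart_def)
  then have "labelled_chart L I B U V G g C K k h0"
    using assms(1) c by (unfold_locales) auto
  then show thesis by (rule that)
qed

theorem proposition3p22:
  fixes L :: "real \<Rightarrow> (real^'n) set"
    and I :: "real set"
    and B :: "(real^'n) set"
    and k k' :: "real \<Rightarrow> real^'n \<Rightarrow> int^'n"
  assumes "asymptotic_lattice L I B"
    and "hbar_continuous I"
    and "good_labelling L I B k"
    and "good_labelling L I B k'"
  shows "\<exists>!\<tau>. \<tau> \<in> GA_plus \<and>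
           (\<exists>h0>0. \<forall>h\<in>I. h \<le> h0 \<longrightarrow> (\<forall>p\<in>L h. k' h p = \<tau> (k h p)))"
proof -
  obtain U V G g C K h0 where a: "labelled_chart L I B U V G g C K k h0"
    using good_labelling_imp_labelled_chart[OF assms(1,3)] .
  obtain U' V' G' g' C' K' h0' where b: "labelled_chart L I B U' V' G' g' C' K' k' h0'"
    using good_labelling_imp_labelled_chart[OF assms(1,4)] .
  interpret labelled_chart_pair L I B U V G g C K k h0 U' V' G' g' C' K' k' h0'
    using a b by (rule labelled_chart_pair.intro)
  have ev: "\<forall>\<^sub>F h in at 0 within I. \<forall>p\<in>L h. k' h p = \<tau> (k h p)"
    if "\<exists>h0>0. \<forall>h\<in>I. h \<le> h0 \<longrightarrow> (\<forall>p\<in>L h. k' h p = \<tau> (k h p))" for \<tau>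
    using that unfolding eventually_at by (auto simp: dist_real_def)
  have "\<tau> = \<tau>'"
    if "\<tau> \<in> GA_plus" "\<exists>h0>0. \<forall>h\<in>I. h \<le> h0 \<longrightarrow> (\<forall>p\<in>L h. k' h p = \<tau> (k h p))"
      and "\<tau>' \<in> GA_plus" "\<exists>h0>0. \<forall>h\<in>I. h \<le> h0 \<longrightarrow> (\<forall>p\<in>L h. k' h p = \<tau>' (k h p))" for \<tau> \<tau>'
  proof (rule a.affine_maps_eq_if_agree_on_labels[OF that(1,3)])
    show "\<forall>\<^sub>F h in at 0 within I. \<forall>p\<in>L h. \<tau> (k h p) = \<tau>' (k h p)"
      using ev[OF that(2)] ev[OF that(4)] by eventually_elim metis
  qed
  then show ?thesis using exists_affine_relabelling[OF assms(2)] by blast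
qed

end
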